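(* Let $\lambda\in\mathbb R$, $q\in\mathbb Z_4$ and $m\in\mathbb Z$. There exists a (nonzero) $K$-finite vector of weight $m$ in $\ker(\Omega''-2\lambda)\subset I''(q,r,s)$ if and only if $$l=\tfrac12\left(1+\sqrt{1+8\lambda}\right)$$ is a positive integer (equivalently, $\lambda=l(l-1)/2$ for $l\in\mathbb Z^{>0}$) and $m\equiv 2l+q\pmod 4$. In this case, if $\lambda\neq0$, there exists a unique (up to scalar multiples) weight vector of weight $m$ in $\ker(\Omega''-2\lambda)\subset I''(q,r,s)$, given by $$F_m(\theta,y)=e^{-im\theta/2}e^{-y^2/2}y^l\,{}_1F_1\!\left(\frac{1+2l-m}{4},\,l+\frac12,\,y^2\right).$$
   Context: Throughout $r=-1/2$ and $s=i/2$. $I''(q,r,s)$ is the complex vector space of all complex-valued $F\in C^\infty(\mathbb R^2)$, $F=F(\theta,y)$, with $F(\theta+j\pi,(-1)^jy)=i^{-jq}F(\theta,y)$ for all $j\in\mathbb Z$. The group $K\cong\mathbb R/4\pi\mathbb Z$ acts on it by translation in $\theta$; a vector of weight $m$ is a function of the form $F(\theta,y)=e^{-im\theta/2}\tilde F(y)$. $\Omega''$ is the differential operator $\Omega''=y^2(2i\partial_\theta-y^2+\partial_y^2)$, which is the operator by which $\Omega'=2\Omega-r(r+2)$ acts on $I''(q,r,s)$, $\Omega$ being the Casimir element of $\mathfrak{sl}(2,\mathbb R)$. ${}_1F_1(a,b,z)=\sum_{n\ge0}\frac{(a)_n}{(b)_n}\frac{z^n}{n!}$ is the confluent hypergeometric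 function of the first kind, where $(a)_n=a(a+1)\cdots(a+n-1)$ and $(a)_0=1$.
   Formalization: For λ=0 the "only if" fails (q=m=1, F=e^{-iθ/2}e^{-y²/2} is in the kernel but l=1 and m≢2l+q mod 4), so the existence criterion gains one extra alternative: λ=0 and m≡q (mod 4); everything else is as stated. *)

theory Defs
  imports "HOL-Analysis.Analysis" "HOL-Number_Theory.Cong"
begin

text \<open>On a finite-dimensional domain, \<open>Ck n F\<close> says that \<open>F\<close> is of class \<open>C\<^sup>n\<close>: all iterated
  directional derivatives of order up to \<open>n\<close> exist (as Frechet derivatives) and are continuous.\<close>

primrec Ck :: "nat \<Rightarrow> ('a::real_normed_vector \<Rightarrow> 'b::real_normed_vector) \<Rightarrow> bool" where
  "Ck 0 F \<longleftrightarrow> continuous_on UNIV F"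
| "Ck (Suc n) F \<longleftrightarrow> (\<forall>p. F differentiable (at p)) \<and> (\<forall>v. Ck n (\<lambda>p. frechet_derivative F (at p) v))"

definition smooth :: "('a::real_normed_vector \<Rightarrow> 'b::real_normed_vector) \<Rightarrow> bool" where
  "smooth F \<longleftrightarrow> (\<forall>n. Ck n F)"

text \<open>Functions on the plane take the pair \<open>(\<theta>, y)\<close>.\<close>

definition d_theta :: "(real \<times> real \<Rightarrow> complex) \<Rightarrow> real \<times> real \<Rightarrow> complex" where
  "d_theta F p = frechet_derivative F (at p) (1, 0)"

definition d_y :: "(real \<times> real \<Rightarrow> complex) \<Rightarrow> real \<times> real \<Rightarrow> complex" where
  "d_y F p = frechet_derivative F (at p) (0, 1)"

text \<open>The space \<open>I''(q,r,s)\<close> for \<open>r = -1/2\<close>, \<open>s = \<i>/2\<close>. The integer \<open>q\<close> represents a class modulo 4,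
  and the definition depends only on that class because \<open>\<i>\<^sup>4 = 1\<close>.\<close>

definition I2 :: "int \<Rightarrow> (real \<times> real \<Rightarrow> complex) set" where
  "I2 q = {F. smooth F \<and>
     (\<forall>j::int. \<forall>\<theta> y. F (\<theta> + of_int j * pi, (-1) powi j * y) = \<i> powi (- (j * q)) * F (\<theta>, y))}"

text \<open>\<open>\<Omega>'' = y\<^sup>2 (2\<i>\<partial>\<^sub>\<theta> - y\<^sup>2 + \<partial>\<^sub>y\<^sup>2)\<close>\<close>

definition Omega2 :: "(real \<times> real \<Rightarrow> complex) \<Rightarrow> real \<times> real \<Rightarrow> complex" where
  "Omega2 F = (\<lambda>(\<theta>, y). (of_real y)\<^sup>2 *
     (2 * \<i> * d_theta F (\<theta>, y) - (of_real y)\<^sup>2 * F (\<theta>, y) + d_y (d_y F) (\<theta>, y)))"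

definition ker_Omega2 :: "int \<Rightarrow> real \<Rightarrow> (real \<times> real \<Rightarrow> complex) set" where
  "ker_Omega2 q lam = {F \<in> I2 q. \<forall>p. Omega2 F p - 2 * of_real lam * F p = 0}"

text \<open>The action of \<open>K \<cong> \<real> / 4\<pi>\<int>\<close>, written as an action of \<open>\<real>\<close>: elements of \<open>I2 q\<close> are
  \<open>4\<pi>\<close>-periodic in \<open>\<theta>\<close>. \<open>K\<close>-finiteness says that the orbit spans a finite-dimensional space.\<close>

definition K_act :: "real \<Rightarrow> (real \<times> real \<Rightarrow> complex) \<Rightarrow> real \<times> real \<Rightarrow> complex" where
  "K_act t F = (\<lambda>(\<theta>, y). F (\<theta> + t, y))"

definition K_finite :: "(real \<times> real \<Rightarrow> complex) \<Rightarrow> bool" where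
  "K_finite F \<longleftrightarrow> (\<exists>B. finite B \<and>
     (\<forall>t. \<exists>c :: (real \<times> real \<Rightarrow> complex) \<Rightarrow> complex. \<forall>p. K_act t F p = (\<Sum>G\<in>B. c G * G p)))"

definition of_weight :: "int \<Rightarrow> (real \<times> real \<Rightarrow> complex) \<Rightarrow> bool" where
  "of_weight m F \<longleftrightarrow>
     (\<exists>f :: real \<Rightarrow> complex. \<forall>\<theta> y. F (\<theta>, y) = exp (- \<i> * of_int m * of_real \<theta> / 2) * f y)"

definition hyp1F1 :: "complex \<Rightarrow> complex \<Rightarrow> complex \<Rightarrow> complex" where
  "hyp1F1 a b z = (\<Sum>n. pochhammer a n / pochhammer b n * z ^ n / fact n)"

text \<open>The root is complex, since \<open>1 + 8 lam\<close> may be negative. The exponents of the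
  equation at \<open>y = 0\<close> are \<open>ell lam\<close> and \<open>1 - ell lam\<close>; for \<open>lam = 0\<close> these are \<open>1\<close> and \<open>0\<close>, and both give
  smooth solutions, the second one in the weights \<open>m = q\<close> modulo 4.\<close>

definition ell :: "real \<Rightarrow> complex" where
  "ell lam = (1 + csqrt (1 + 8 * of_real lam)) / 2"

definition F_sol :: "int \<Rightarrow> nat \<Rightarrow> real \<times> real \<Rightarrow> complex" where
  "F_sol m l = (\<lambda>(\<theta>, y). exp (- \<i> * of_int m * of_real \<theta> / 2) * exp (- (of_real y)\<^sup>2 / 2) *
     of_real y ^ l *
     hyp1F1 ((1 + 2 * of_nat l - of_int m) / 4) (of_nat l + 1 / 2) ((of_real y)\<^sup>2))"

end

theory Submission
  imports Defs "HOL-Complex_Analysis.Cauchy_Integral_Formula"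
begin

text \<open>On \<open>F = e\<^sup>-\<^sup>i\<^sup>m\<^sup>\<theta>\<^sup>/\<^sup>2 f(y)\<close> the eigenvalue equation becomes
  \<open>y\<^sup>2 (f'' + (m - y\<^sup>2) f) = 2 \<lambda> f\<close>, which has a regular singularity at \<open>0\<close> with indicial equation
  \<open>k (k - 1) = 2 \<lambda>\<close>. A smooth solution that is flat at \<open>0\<close> vanishes by an energy estimate, so a nonzero
  solution has a finite order of vanishing \<open>k\<close>, which solves the indicial equation. The relation
  \<open>f(-y) = i\<^sup>m\<^sup>-\<^sup>q f(y)\<close> then forces \<open>m = 2 k + q\<close> modulo 4. If \<open>\<lambda> \<noteq> 0\<close>, only one root is nonnegative,
  so two solutions differ, after scaling, by a flat one. Conversely \<open>F_sol m l\<close> solves the equation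
  by Kummer's equation for \<open>\<^sub>1F\<^sub>1\<close>, also for \<open>l = 0\<close>, where it is the even solution for \<open>\<lambda> = 0\<close>.\<close>

section \<open>Smooth solutions of Euler-type equations\<close>

text \<open>All derivatives are carried as one sequence, so that flatness at \<open>0\<close>, the
  Leibniz rule and repeated differentiation of an equation become statements about the
  index.\<close>

definition deriv_seq :: "(nat \<Rightarrow> real \<Rightarrow> complex) \<Rightarrow> bool" where
  "deriv_seq D \<longleftrightarrow> (\<forall>n y. (D n has_vector_derivative D (Suc n) y) (at y))"

lemma deriv_seqD: "deriv_seq D \<Longrightarrow> (D n has_vector_derivative D (Suc n) y) (at y)"
  by (simp add: deriv_seq_def)

lemma deriv_seq_shift: "deriv_seq D \<Longrightarrow> deriv_seq (\<lambda>n. D (n + k))"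
  by (simp add: deriv_seq_def)

lemma deriv_seq_add:
  assumes "deriv_seq D" "deriv_seq E"
  shows "deriv_seq (\<lambda>n y. D n y + E n y)"
  using assms unfolding deriv_seq_def by (auto intro!: derivative_eq_intros)

lemma deriv_seq_cmult:
  assumes "deriv_seq D"
  shows "deriv_seq (\<lambda>n y. c * D n y)"
  using assms unfolding deriv_seq_def
  by (auto intro!: has_vector_derivative_mult_right)

text \<open>The chain rule contributes one sign per derivative. At \<open>0\<close> this later ties
  the symmetry of a solution to the parity of its order of vanishing.\<close>

lemma deriv_seq_reflect:
  assumes "deriv_seq D"
  shows "deriv_seq (\<lambda>n y. (-1) ^ n * D n (- y))"
  unfolding deriv_seq_def
proof (intro allI)
  fix n y
  have "((D n \<circ> uminus) has_vector_derivative (-1) *\<^sub>R D (Suc n) (- y)) (at y)"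
    by (rule vector_diff_chain_at) (auto intro!: derivative_eq_intros deriv_seqD[OF assms])
  from has_vector_derivative_mult_right[OF this, of "(-1) ^ n"]
  show "((\<lambda>y. (-1) ^ n * D n (- y)) has_vector_derivative (-1) ^ Suc n * D (Suc n) (- y)) (at y)"
    by (simp add: o_def)
qed

text \<open>Uniqueness of derivatives propagates an identity upwards from index \<open>0\<close>, so
  functional equations can be differentiated any number of times.\<close>

lemma deriv_seq_unique:
  assumes "deriv_seq D" "deriv_seq E" "\<And>y. D 0 y = E 0 y"
  shows "D n y = E n y"
proof (induction n arbitrary: y)
  case (Suc n)
  have "D n = E n" using Suc by blast
  then show ?case
    using deriv_seqD[OF assms(1), of n y] deriv_seqD[OF assms(2), of n y]
    by (simp add: vector_derivative_unique_at)
qed (use assms in auto)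

text \<open>If \<open>D\<close> lists the derivatives of \<open>f\<close>, then by Leibniz \<open>mult_id D\<close> lists those of \<open>y f\<close>.\<close>

definition mult_id :: "(nat \<Rightarrow> real \<Rightarrow> complex) \<Rightarrow> nat \<Rightarrow> real \<Rightarrow> complex" where
  "mult_id D n y = of_real y * D n y + of_nat n * D (n - 1) y"

lemma deriv_seq_mult_id:
  assumes "deriv_seq D"
  shows "deriv_seq (mult_id D)"
  unfolding deriv_seq_def
proof (intro allI)
  fix n y
  have 1: "((\<lambda>y. of_real y * D n y) has_vector_derivative D n y + of_real y * D (Suc n) y) (at y)"
    using deriv_seqD[OF assms, of n y] by (auto intro!: derivative_eq_intros simp: algebra_simps)
  \<comment> \<open>For \<open>n = 0\<close> the truncated index \<open>n - 1\<close> is harmless,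
    because the factor \<open>of_nat n\<close> vanishes.\<close>
  have 2: "((\<lambda>y. of_nat n * D (n - 1) y) has_vector_derivative of_nat n * D n y) (at y)"
    using deriv_seqD[OF assms, of "n - 1" y]
    by (cases n) (auto intro!: has_vector_derivative_mult_right)
  show "(mult_id D n has_vector_derivative mult_id D (Suc n) y) (at y)"
    using has_vector_derivative_add[OF 1 2] unfolding mult_id_def
    by (simp add: algebra_simps)
qed

text \<open>Induction on \<open>k\<close> for all \<open>n\<close> at once: by the mean value
  inequality from \<open>0\<close>, a bound of order \<open>k\<close> on the next derivative gains
  one factor \<open>y\<close>. The base case is compactness.\<close>

lemma deriv_seq_flat_bound:
  assumes D: "deriv_seq D" and z: "\<And>n. D n 0 = 0"
  shows "\<exists>C. \<forall>y\<in>{0..1}. norm (D n y) \<le> C * y ^ k"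
proof (induction k arbitrary: n)
  case 0
  have "continuous_on {0..1} (D n)"
    using deriv_seqD[OF D] has_vector_derivative_continuous
    by (metis continuous_at_imp_continuous_on)
  then have "compact (D n ` {0..1})" by (intro compact_continuous_image) auto
  then have "bounded (D n ` {0..1})" by (rule compact_imp_bounded)
  then show ?case by (auto simp: bounded_iff)
next
  case (Suc k)
  from Suc[of "Suc n"] obtain C where C: "\<And>y. y \<in> {0..1} \<Longrightarrow> norm (D (Suc n) y) \<le> C * y ^ k"
    by blast
  \<comment> \<open>The sign of \<open>C\<close> is read off at the point \<open>1\<close>; it is
    what allows \<open>x ^ k\<close> to be enlarged to \<open>y ^ k\<close> below.\<close>
  have C0: "C \<ge> 0" using order_trans[OF norm_ge_zero C[of 1]] by simp
  have "norm (D n y) \<le> C * y ^ Suc k" if y: "y \<in> {0..1}" for y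
  proof -
    have "norm (D n y - D n 0) \<le> C * y ^ k * norm (y - 0)"
    proof (rule differentiable_bound[where S = "{0..y}" and f' = "\<lambda>x h. h *\<^sub>R D (Suc n) x"])
      show "(D n has_derivative (\<lambda>h. h *\<^sub>R D (Suc n) x)) (at x within {0..y})" for x
        using deriv_seqD[OF D] has_vector_derivative_at_within
        unfolding has_vector_derivative_def by (blast intro: has_derivative_at_withinI)
      show "onorm (\<lambda>h. h *\<^sub>R D (Suc n) x) \<le> C * y ^ k" if "x \<in> {0..y}" for x
      proof -
        have "norm (D (Suc n) x) \<le> C * x ^ k" using C[of x] that y by auto
        also have "\<dots> \<le> C * y ^ k" using that C0 by (intro mult_left_mono power_mono) auto
        finally show ?thesis by (simp add: onorm_scaleR_left onorm_id bounded_linear_ident)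
      qed
    qed (use y in auto)
    then show ?thesis using y z by (simp add: mult_ac)
  qed
  then show ?case by blast
qed

text \<open>The energy \<open>E = |f|\<^sup>2 + |y f'|\<^sup>2\<close> satisfies \<open>y E' \<le> c E\<close>, so that \<open>E / y\<^sup>c\<close> is
  nonincreasing, and it tends to \<open>0\<close> at the origin by flatness.\<close>

lemma euler_ode_flat_imp_zero:
  fixes Q :: "real \<Rightarrow> complex"
  assumes D: "deriv_seq D" and z: "\<And>n. D n 0 = 0"
    and ode: "\<And>y. (of_real y)\<^sup>2 * D 2 y = Q y * D 0 y"
    and Q: "continuous_on UNIV Q" and y: "y \<ge> 0"
  shows "D 0 y = 0"
proof (cases "y = 0")
  case False
  with y have y: "y > 0" by simp
  have "compact (Q ` {0..y})"
    using Q by (intro compact_continuous_image) (auto intro: continuous_on_subset)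
  then obtain M where M: "\<And>t. t \<in> {0..y} \<Longrightarrow> norm (Q t) \<le> M"
    using compact_imp_bounded by (fastforce simp: bounded_iff)
  have M0: "M \<ge> 0" using order_trans[OF norm_ge_zero M[of 0]] y by simp
  \<comment> \<open>\<open>3 + M\<close> is the constant of the energy inequality \<open>yE\<close>;
    rounding it up to a natural number makes \<open>t ^ c\<close> an ordinary power.\<close>
  obtain c :: nat where c: "3 + M \<le> real c" using real_arch_simple by blast
  then have "c > 0" using M0 by (cases c) auto
  define E where "E t = D 0 t \<bullet> D 0 t + (t *\<^sub>R D 1 t) \<bullet> (t *\<^sub>R D 1 t)" for t
  define E' where "E' t = 2 * (D 0 t \<bullet> D 1 t) + 2 * ((t *\<^sub>R D 1 t) \<bullet> (D 1 t + t *\<^sub>R D 2 t))" for t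
  have D0: "(D 0 has_derivative (\<lambda>h. h *\<^sub>R D 1 t)) (at t)" for t
    using deriv_seqD[OF D, of 0 t] by (simp add: has_vector_derivative_def)
  have D1: "(D 1 has_derivative (\<lambda>h. h *\<^sub>R D 2 t)) (at t)" for t
    using deriv_seqD[OF D, of 1 t] by (simp add: has_vector_derivative_def numeral_2_eq_2)
  have E: "(E has_real_derivative E' t) (at t)" for t
    unfolding E_def E'_def has_field_derivative_def
    by (rule derivative_eq_intros D0 D1 refl)+
       (auto simp: fun_eq_iff inner_add_left inner_add_right inner_commute algebra_simps)
  have yE: "t * E' t \<le> real c * E t" if t: "t \<in> {0..y}" for t
  proof -
    define a b where "a = D 0 t" and "b = t *\<^sub>R D 1 t"
    have Et: "E t = (norm a)\<^sup>2 + (norm b)\<^sup>2"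
      by (simp only: E_def a_def b_def power2_norm_eq_inner)
    \<comment> \<open>The equation controls \<open>D 2 t\<close> only after multiplication by
      \<open>t\<^sup>2\<close>, which is why the energy weights \<open>D 1 t\<close> with
      \<open>t\<close>.\<close>
    have t2: "t *\<^sub>R (t *\<^sub>R D 2 t) = Q t * a"
      using ode[of t] by (simp add: scaleR_conv_of_real power2_eq_square a_def mult_ac)
    have "t * E' t = 2 * (a \<bullet> b) + 2 * (b \<bullet> b) + 2 * (b \<bullet> (t *\<^sub>R (t *\<^sub>R D 2 t)))"
      by (simp add: E'_def a_def b_def inner_add_right algebra_simps)
    also have "\<dots> = 2 * (a \<bullet> b) + 2 * (b \<bullet> b) + 2 * (b \<bullet> (Q t * a))" by (simp only: t2)
    also have "b \<bullet> (Q t * a) \<le> norm b * (M * norm a)"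
      using norm_cauchy_schwarz[of b "Q t * a"] M[OF t]
      by (smt (verit, best) mult_left_mono mult_right_mono norm_ge_zero norm_mult)
    also have "a \<bullet> b \<le> norm a * norm b" by (rule norm_cauchy_schwarz)
    finally have 1: "t * E' t \<le> (1 + M) * (2 * norm a * norm b) + 2 * (norm b)\<^sup>2"
      by (simp add: algebra_simps power2_norm_eq_inner)
    have *: "(1 + M) * (2 * norm a * norm b) \<le> (1 + M) * ((norm a)\<^sup>2 + (norm b)\<^sup>2)"
      using M0 sum_squares_bound[of "norm a" "norm b"] by (intro mult_left_mono) auto
    have "t * E' t \<le> (3 + M) * E t"
    proof -
      have "(3 + M) * E t = (1 + M) * ((norm a)\<^sup>2 + (norm b)\<^sup>2) + 2 * (norm b)\<^sup>2 + 2 * (norm a)\<^sup>2"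
        unfolding Et by algebra
      moreover have "0 \<le> (norm a)\<^sup>2" by simp
      ultimately show ?thesis using * 1 by linarith
    qed
    also have "\<dots> \<le> real c * E t" using c unfolding Et by (intro mult_right_mono) auto
    finally show ?thesis .
  qed
  have mono: "E y / y ^ c \<le> E e / e ^ c" if e: "0 < e" "e \<le> y" for e
  proof (rule DERIV_nonpos_imp_nonincreasing[OF e(2)])
    fix t assume t: "e \<le> t" "t \<le> y"
    then have t0: "t > 0" using e by simp
    have "((\<lambda>t. E t / t ^ c) has_real_derivative
        (E' t * t ^ c - E t * (real c * t ^ (c - 1))) / (t ^ c * t ^ c)) (at t)"
      using t0 by (auto intro!: derivative_eq_intros E)
    moreover have "E' t * t ^ c - E t * (real c * t ^ (c - 1)) = (t * E' t - real c * E t) * t ^ (c - 1)"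
      using \<open>c > 0\<close> by (cases c) (auto simp: algebra_simps)
    moreover have "(t * E' t - real c * E t) * t ^ (c - 1) \<le> 0"
      using yE[of t] t t0 by (intro mult_nonpos_nonneg) auto
    ultimately show "\<exists>d. ((\<lambda>t. E t / t ^ c) has_real_derivative d) (at t) \<and> d \<le> 0"
      using t0 by (intro exI conjI) (assumption, simp add: divide_nonpos_pos)
  qed
  \<comment> \<open>Order \<open>Suc c\<close> is enough: the energy at \<open>e\<close> is then
    bounded by a multiple of \<open>(e ^ Suc c)\<^sup>2\<close>, and a factor \<open>e\<close>
    survives division by \<open>e ^ c\<close>.\<close>
  obtain A where A: "\<And>t. t \<in> {0..1} \<Longrightarrow> norm (D 0 t) \<le> A * t ^ Suc c"
    using deriv_seq_flat_bound[OF D z] by metis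
  obtain B where B: "\<And>t. t \<in> {0..1} \<Longrightarrow> norm (D 1 t) \<le> B * t ^ Suc c"
    using deriv_seq_flat_bound[OF D z] by metis
  have small: "E y / y ^ c \<le> (A\<^sup>2 + B\<^sup>2) * e" if e: "0 < e" "e \<le> min y 1" for e
  proof -
    have e1: "e ^ n \<le> 1" for n using e by (simp add: power_le_one)
    have "(norm (D 0 e))\<^sup>2 \<le> (A * e ^ Suc c)\<^sup>2" using A[of e] e by (intro power_mono) auto
    moreover have "(norm (e *\<^sub>R D 1 e))\<^sup>2 \<le> (B * e ^ Suc c)\<^sup>2"
    proof (rule power_mono)
      have "norm (e *\<^sub>R D 1 e) \<le> 1 * norm (D 1 e)"
        unfolding norm_scaleR using e by (intro mult_right_mono) auto
      then show "norm (e *\<^sub>R D 1 e) \<le> B * e ^ Suc c" using B[of e] e by (simp del: power_Suc)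
    qed auto
    ultimately have "E e \<le> (A\<^sup>2 + B\<^sup>2) * (e ^ Suc c)\<^sup>2"
      unfolding E_def power2_norm_eq_inner[symmetric] by (simp add: power_mult_distrib algebra_simps)
    also have "\<dots> = (A\<^sup>2 + B\<^sup>2) * (e * e ^ c) * e ^ Suc c" by (simp add: power2_eq_square)
    also have "\<dots> \<le> (A\<^sup>2 + B\<^sup>2) * (e * e ^ c) * 1" using e by (intro mult_left_mono[OF e1]) auto
    finally have "E e / e ^ c \<le> (A\<^sup>2 + B\<^sup>2) * e" using e by (simp add: divide_simps mult_ac)
    with mono[of e] e show ?thesis by auto
  qed
  have "E y / y ^ c \<le> 0"
  proof (rule tendsto_lowerbound)
    show "((\<lambda>e. (A\<^sup>2 + B\<^sup>2) * e) \<longlongrightarrow> 0) (at_right 0)" by (auto intro!: tendsto_eq_intros)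
    show "\<forall>\<^sub>F e in at_right 0. E y / y ^ c \<le> (A\<^sup>2 + B\<^sup>2) * e"
      using eventually_at_right_real[of 0 "min y 1"] y small by (auto elim!: eventually_mono)
  qed auto
  then have "E y \<le> 0" using zero_less_power[OF y, of c] by (simp add: divide_le_0_iff)
  then have "D 0 y \<bullet> D 0 y = 0"
    unfolding E_def using inner_ge_zero[of "D 0 y"] inner_ge_zero[of "y *\<^sub>R D 1 y"] by linarith
  then show ?thesis by simp
qed (simp add: z)

section \<open>The confluent hypergeometric function\<close>

definition hyp_coeff :: "complex \<Rightarrow> complex \<Rightarrow> nat \<Rightarrow> complex" where
  "hyp_coeff a b n = pochhammer a n / pochhammer b n / fact n"

lemma hyp1F1_altdef: "hyp1F1 a b z = (\<Sum>n. hyp_coeff a b n * z ^ n)"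
  by (simp add: hyp1F1_def hyp_coeff_def)

lemma hyp_coeff_Suc:
  "hyp_coeff a b (Suc n) = hyp_coeff a b n * ((a + of_nat n) / ((b + of_nat n) * of_nat (Suc n)))"
  by (simp add: hyp_coeff_def pochhammer_Suc)

text \<open>Ratio test: \<open>(a + n) / (b + n)\<close> tends to \<open>1\<close> while
  \<open>z / (n + 1)\<close> tends to \<open>0\<close>. If \<open>b\<close> is a nonpositive
  integer, division by zero makes the series terminate.\<close>

lemma summable_hyp1F1: "summable (\<lambda>n. hyp_coeff a b n * z ^ n)"
proof -
  have "(\<lambda>n. (a + of_nat n) / (b + of_nat n)) \<longlonglongrightarrow> 1"
  proof -
    have 1: "(\<lambda>n. c / of_nat n + 1) \<longlonglongrightarrow> 1" for c :: complex
      using tendsto_add[OF lim_const_over_n[of c] tendsto_const[of 1]] by simp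
    have "(\<lambda>n. (a / of_nat n + 1) / (b / of_nat n + 1)) \<longlonglongrightarrow> 1 / 1"
      by (intro tendsto_divide 1) auto
    moreover have "\<forall>\<^sub>F n in sequentially.
        (a / of_nat n + 1) / (b / of_nat n + 1) = (a + of_nat n) / (b + of_nat n)"
      using eventually_gt_at_top[of 0] by eventually_elim (auto simp: divide_simps)
    ultimately show ?thesis by (simp add: tendsto_cong)
  qed
  from tendsto_mult[OF this LIMSEQ_Suc[OF lim_const_over_n[of z]]]
  have "(\<lambda>n. (a + of_nat n) / (b + of_nat n) * (z / of_nat (Suc n))) \<longlonglongrightarrow> 0" by simp
  then have "\<forall>\<^sub>F n in sequentially. norm ((a + of_nat n) / (b + of_nat n) * (z / of_nat (Suc n))) < 1/2"
    using tendsto_norm_zero order_tendstoD(2)[of _ 0 sequentially "1/2"] by fastforce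
  then obtain N where N:
      "\<And>n. n \<ge> N \<Longrightarrow> norm ((a + of_nat n) / (b + of_nat n) * (z / of_nat (Suc n))) < 1/2"
    by (auto simp: eventually_sequentially)
  show ?thesis
  proof (rule summable_ratio_test[of "1/2" N])
    fix n assume n: "n \<ge> N"
    have "hyp_coeff a b (Suc n) * z ^ Suc n =
        (a + of_nat n) / (b + of_nat n) * (z / of_nat (Suc n)) * (hyp_coeff a b n * z ^ n)"
      by (simp add: hyp_coeff_Suc)
    then have "norm (hyp_coeff a b (Suc n) * z ^ Suc n) =
        norm ((a + of_nat n) / (b + of_nat n) * (z / of_nat (Suc n))) * norm (hyp_coeff a b n * z ^ n)"
      by (simp only: norm_mult)
    also have "\<dots> \<le> 1/2 * norm (hyp_coeff a b n * z ^ n)"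
      by (intro mult_right_mono) (use N[OF n] in auto)
    finally show "norm (hyp_coeff a b (Suc n) * z ^ Suc n) \<le> 1/2 * norm (hyp_coeff a b n * z ^ n)" .
  qed simp
qed

lemma hyp1F1_zero [simp]: "hyp1F1 a b 0 = 1"
  unfolding hyp1F1_altdef powser_zero by (simp add: hyp_coeff_def)

text \<open>Kummer's equation is the coefficient recursion
  \<open>(n + b) (n + 1) c (n + 1) = (n + a) c n\<close> read as an identity of power series; the
  hypothesis on \<open>b\<close> clears its denominators.\<close>

lemma hyp1F1_kummer:
  assumes b: "\<And>n. b + of_nat n \<noteq> 0"
  shows "\<exists>w1 w2. \<forall>z. (hyp1F1 a b has_field_derivative w1 z) (at z) \<and>
           (w1 has_field_derivative w2 z) (at z) \<and>
           z * w2 z + (b - z) * w1 z = a * hyp1F1 a b z"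
proof -
  define c where "c = hyp_coeff a b"
  define w1 where "w1 = (\<lambda>z. \<Sum>n. diffs c n * z ^ n)"
  define w2 where "w2 = (\<lambda>z. \<Sum>n. diffs (diffs c) n * z ^ n)"
  have s0: "summable (\<lambda>n. c n * z ^ n)" for z unfolding c_def by (rule summable_hyp1F1)
  have s1: "summable (\<lambda>n. diffs c n * z ^ n)" for z using s0 by (rule termdiff_converges_all)
  have s2: "summable (\<lambda>n. diffs (diffs c) n * z ^ n)" for z
    using s1 by (rule termdiff_converges_all)
  have w: "hyp1F1 a b = (\<lambda>z. \<Sum>n. c n * z ^ n)" by (simp add: fun_eq_iff hyp1F1_altdef c_def)
  have "(hyp1F1 a b has_field_derivative w1 z) (at z)" for z
    unfolding w w1_def using s0 by (rule termdiffs_strong_converges_everywhere)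
  moreover have "(w1 has_field_derivative w2 z) (at z)" for z
    unfolding w1_def w2_def using s1 by (rule termdiffs_strong_converges_everywhere)
  moreover have "z * w2 z + (b - z) * w1 z = a * hyp1F1 a b z" for z
  proof -
    \<comment> \<open>Multiplying a termwise derivative by \<open>z\<close> gives the Euler
      operator, which scales the \<open>n\<close>-th coefficient by \<open>n\<close>. The term at
      \<open>n = 0\<close> is zero, so reindexing loses nothing.\<close>
    have shift: "(\<lambda>n. of_nat n * u n * z ^ n) sums (z * (\<Sum>n. diffs u n * z ^ n))"
      if "summable (\<lambda>n. diffs u n * z ^ n)" for u
    proof -
      have "(\<lambda>n. z * (diffs u n * z ^ n)) sums (z * (\<Sum>n. diffs u n * z ^ n))"
        using summable_sums[OF that] by (rule sums_mult)
      then have "(\<lambda>n. of_nat (Suc n) * u (Suc n) * z ^ Suc n) sums (z * (\<Sum>n. diffs u n * z ^ n))"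
        by (simp add: diffs_def mult_ac)
      then show ?thesis using sums_Suc_iff[of "\<lambda>n. of_nat n * u n * z ^ n"] by simp
    qed
    have "(\<lambda>n. of_nat n * diffs c n * z ^ n + b * (diffs c n * z ^ n) - of_nat n * c n * z ^ n)
        sums (z * w2 z + b * w1 z - z * w1 z)"
      unfolding w1_def w2_def
      by (intro sums_add sums_diff sums_mult shift s1 s2 summable_sums)
    moreover have "of_nat n * diffs c n * z ^ n + b * (diffs c n * z ^ n) - of_nat n * c n * z ^ n
        = a * (c n * z ^ n)" for n
    proof -
      have "(of_nat n + b) * diffs c n = (a + of_nat n) * c n"
        using b[of n] unfolding diffs_def c_def hyp_coeff_Suc by (simp add: add.commute del: of_nat_Suc)
      then have "(of_nat n + b) * diffs c n * z ^ n = (a + of_nat n) * c n * z ^ n" by simp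
      then show ?thesis by (simp add: algebra_simps)
    qed
    ultimately have "(\<lambda>n. a * (c n * z ^ n)) sums (z * w2 z + b * w1 z - z * w1 z)" by simp
    moreover have "(\<lambda>n. a * (c n * z ^ n)) sums (a * hyp1F1 a b z)"
      unfolding w by (intro sums_mult summable_sums s0)
    ultimately show ?thesis using sums_unique2 by (fastforce simp: algebra_simps)
  qed
  ultimately show ?thesis by blast
qed

text \<open>The \<open>y\<close>-dependence of \<open>F_sol\<close>, with a complex argument: being
  entire, it has all derivatives at once.\<close>

definition radial :: "int \<Rightarrow> nat \<Rightarrow> complex \<Rightarrow> complex" where
  "radial m l z = exp (- z\<^sup>2 / 2) * z ^ l *
     hyp1F1 ((1 + 2 * of_nat l - of_int m) / 4) (of_nat l + 1 / 2) (z\<^sup>2)"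

lemma nat_plus_half_plus_nat_nonzero: "of_nat l + 1 / 2 + of_nat n \<noteq> (0 :: complex)"
proof
  assume "of_nat l + 1 / 2 + of_nat n = (0 :: complex)"
  then have "Re (of_nat l + 1 / 2 + of_nat n) = 0" by (simp only: zero_complex.sel)
  then show False by simp
qed

text \<open>The substitution of \<open>z\<^sup>2\<close> into Kummer's equation is carried out with
  \<open>z\<close> times the derivative. Nothing is divided by \<open>z\<close>, so the identity
  holds at \<open>z = 0\<close> as well.\<close>

lemma radial_ode:
  "radial m l holomorphic_on UNIV"
  "z\<^sup>2 * (deriv (deriv (radial m l)) z + (of_int m - z\<^sup>2) * radial m l z) =
     of_nat l * (of_nat l - 1) * radial m l z"
proof -
  define a :: complex where "a = (1 + 2 * of_nat l - of_int m) / 4"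
  define b :: complex where "b = of_nat l + 1 / 2"
  have "b + of_nat n \<noteq> 0" for n
    unfolding b_def by (rule nat_plus_half_plus_nat_nonzero)
  from hyp1F1_kummer[OF this] obtain w1 w2 where
    w: "(hyp1F1 a b has_field_derivative w1 z) (at z)" and
    w1: "(w1 has_field_derivative w2 z) (at z)" and
    kummer: "z * w2 z + (b - z) * w1 z = a * hyp1F1 a b z" for z by metis
  define w0 where "w0 = hyp1F1 a b"
  define f where "f = radial m l"
  define e where "e = (\<lambda>z::complex. exp (- z\<^sup>2 / 2) * z ^ l)"
  define e' where "e' = (\<lambda>z::complex. exp (- z\<^sup>2 / 2) * (of_nat l * z ^ (l - 1)) - z * exp (- z\<^sup>2 / 2) * z ^ l)"
  have f: "f z = e z * w0 (z\<^sup>2)" for z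
    by (simp add: f_def radial_def e_def w0_def a_def b_def)
  have e': "(e has_field_derivative e' z) (at z)" for z
    unfolding e_def e'_def by (auto intro!: derivative_eq_intros)
  have ze': "z * e' z = (of_nat l - z\<^sup>2) * e z" for z
    unfolding e_def e'_def by (cases l) (auto simp: algebra_simps power2_eq_square)
  note ch = DERIV_chain2[of _ _ "\<lambda>z. z\<^sup>2"]
  have w0: "((\<lambda>z. w0 (z\<^sup>2)) has_field_derivative w1 (z\<^sup>2) * (2 * z)) (at z)" for z
    unfolding w0_def by (rule ch[OF w]) (auto intro!: derivative_eq_intros)
  have w1': "((\<lambda>z. w1 (z\<^sup>2)) has_field_derivative w2 (z\<^sup>2) * (2 * z)) (at z)" for z
    by (rule ch[OF w1]) (auto intro!: derivative_eq_intros)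
  have f': "(f has_field_derivative e' z * w0 (z\<^sup>2) + e z * (w1 (z\<^sup>2) * (2 * z))) (at z)" for z
    unfolding f[abs_def] using DERIV_mult[OF e' w0] by (simp add: algebra_simps)
  show hol: "radial m l holomorphic_on UNIV"
    using f' unfolding f_def holomorphic_on_def field_differentiable_def
    by (blast intro: has_field_derivative_at_within)
  have hol': "deriv f holomorphic_on UNIV" using hol unfolding f_def by (rule holomorphic_deriv) auto
  \<comment> \<open>\<open>T\<close> is a closed form of \<open>z * deriv f z\<close> without
    \<open>e'\<close>; differentiating it produces the second derivative of
    \<open>f\<close>.\<close>
  define T where "T = (\<lambda>z. e z * ((of_nat l - z\<^sup>2) * w0 (z\<^sup>2) + 2 * z\<^sup>2 * w1 (z\<^sup>2)))"
  have T: "z * deriv f z = T z" for z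
  proof -
    have "z * deriv f z = (z * e' z) * w0 (z\<^sup>2) + 2 * z\<^sup>2 * e z * w1 (z\<^sup>2)"
      using DERIV_imp_deriv[OF f'] by (simp add: algebra_simps power2_eq_square)
    then show ?thesis by (simp add: ze' T_def algebra_simps)
  qed
  have T': "(T has_field_derivative e' z * ((of_nat l - z\<^sup>2) * w0 (z\<^sup>2) + 2 * z\<^sup>2 * w1 (z\<^sup>2)) +
     e z * (- 2 * z * w0 (z\<^sup>2) + (of_nat l - z\<^sup>2) * (w1 (z\<^sup>2) * (2 * z)) + 4 * z * w1 (z\<^sup>2)
        + 2 * z\<^sup>2 * (w2 (z\<^sup>2) * (2 * z)))) (at z)" for z
    unfolding T_def
    by (rule derivative_eq_intros e' w0 w1' refl)+ (simp add: algebra_simps)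
  \<comment> \<open>Multiplies the derivative identity by \<open>z\<close> and regroups it, so that
    \<open>z * e' z\<close> and \<open>z * deriv f z\<close> appear literally and can be rewritten
    by \<open>ze'\<close> and \<open>T\<close>.\<close>
  have alg: "z * (z * u) = (z * p) * v + z * r - z * d" if "d + z * u = p * v + r" for u p v r d
    using arg_cong[OF that, of "(*) z"] by (simp add: algebra_simps)
  have "(deriv f has_field_derivative deriv (deriv f) z) (at z)"
    using hol' by (simp add: DERIV_deriv_iff_field_differentiable holomorphic_on_def)
  then have "((\<lambda>z. z * deriv f z) has_field_derivative deriv f z + z * deriv (deriv f) z) (at z)"
    by (auto intro!: derivative_eq_intros)
  then have "deriv f z + z * deriv (deriv f) z =
     e' z * ((of_nat l - z\<^sup>2) * w0 (z\<^sup>2) + 2 * z\<^sup>2 * w1 (z\<^sup>2)) +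
     e z * (- 2 * z * w0 (z\<^sup>2) + (of_nat l - z\<^sup>2) * (w1 (z\<^sup>2) * (2 * z)) + 4 * z * w1 (z\<^sup>2)
        + 2 * z\<^sup>2 * (w2 (z\<^sup>2) * (2 * z)))"
    using T' unfolding T by (rule DERIV_unique)
  then have "z * (z * deriv (deriv f) z) =
     (z * e' z) * ((of_nat l - z\<^sup>2) * w0 (z\<^sup>2) + 2 * z\<^sup>2 * w1 (z\<^sup>2)) +
     z * (e z * (- 2 * z * w0 (z\<^sup>2) + (of_nat l - z\<^sup>2) * (w1 (z\<^sup>2) * (2 * z)) + 4 * z * w1 (z\<^sup>2)
        + 2 * z\<^sup>2 * (w2 (z\<^sup>2) * (2 * z)))) - z * deriv f z"
    by (rule alg)
  \<comment> \<open>With \<open>b = l + 1/2\<close>, the terms in \<open>w1\<close> and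
    \<open>w2\<close> combine into the left side of Kummer's equation at the argument
    \<open>z\<^sup>2\<close>.\<close>
  also have "\<dots> = e z * (
       ((of_nat l - z\<^sup>2) * (of_nat l - z\<^sup>2) - 2 * z\<^sup>2 - (of_nat l - z\<^sup>2)) * w0 (z\<^sup>2)
       + 4 * z\<^sup>2 * (z\<^sup>2 * w2 (z\<^sup>2) + (b - z\<^sup>2) * w1 (z\<^sup>2)))"
    unfolding ze' T T_def b_def by (simp add: field_simps power2_eq_square)
  also have "\<dots> = e z * (
       ((of_nat l - z\<^sup>2) * (of_nat l - z\<^sup>2) - 2 * z\<^sup>2 - (of_nat l - z\<^sup>2)) * w0 (z\<^sup>2)
       + 4 * z\<^sup>2 * (a * w0 (z\<^sup>2)))"
    unfolding kummer w0_def ..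
  \<comment> \<open>The value of \<open>a\<close> cancels the \<open>l\<close>-dependent part of the
    \<open>z\<^sup>2\<close> coefficient and leaves \<open>- m\<close>.\<close>
  also have "\<dots> = (of_nat l * (of_nat l - 1) - (of_int m - z\<^sup>2) * z\<^sup>2) * f z"
    unfolding f a_def by (simp add: field_simps power2_eq_square)
  finally show "z\<^sup>2 * (deriv (deriv (radial m l)) z + (of_int m - z\<^sup>2) * radial m l z) =
     of_nat l * (of_nat l - 1) * radial m l z"
    unfolding f_def by (simp add: algebra_simps power2_eq_square)
qed

section \<open>The explicit weight vectors\<close>

lemma Ck_add: "Ck n F \<Longrightarrow> Ck n G \<Longrightarrow> Ck n (\<lambda>p. F p + G p)"
proof (induction n arbitrary: F G)
  case (Suc n)
  then have "frechet_derivative (\<lambda>p. F p + G p) (at p) v =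
      frechet_derivative F (at p) v + frechet_derivative G (at p) v" for p v
    by (subst frechet_derivative_at[symmetric, OF has_derivative_add])
       (auto simp: frechet_derivative_works)
  then show ?case using Suc by simp
qed (simp add: continuous_on_add)

text \<open>Separated products of entire functions: both partial derivatives stay in this class,
  which reduces calculus on the plane to complex derivatives of the factors.\<close>

definition prod_fun :: "(complex \<Rightarrow> complex) \<Rightarrow> (complex \<Rightarrow> complex) \<Rightarrow> real \<times> real \<Rightarrow> complex" where
  "prod_fun g h = (\<lambda>(\<theta>, y). g (of_real \<theta>) * h (of_real y))"

lemma frechet_derivative_prod_fun:
  assumes g: "g holomorphic_on UNIV" and h: "h holomorphic_on UNIV"
  shows "prod_fun g h differentiable (at p)"
    and "frechet_derivative (prod_fun g h) (at p) v =
      of_real (fst v) * prod_fun (deriv g) h p + of_real (snd v) * prod_fun g (deriv h) p"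
proof -
  have comp: "((\<lambda>p. k (of_real (u p))) has_derivative (\<lambda>v. deriv k (of_real (u p)) * of_real (u v))) (at p)"
    if k: "k holomorphic_on UNIV" and u: "bounded_linear u" for k :: "complex \<Rightarrow> complex" and u :: "real \<times> real \<Rightarrow> real"
  proof -
    have 1: "((\<lambda>p. complex_of_real (u p)) has_derivative (\<lambda>v. of_real (u v))) (at p)"
      using u by (intro bounded_linear_imp_has_derivative bounded_linear_compose[OF bounded_linear_of_real])
    have "(k has_derivative (*) (deriv k (of_real (u p)))) (at (of_real (u p)))"
      using k by (simp add: has_field_derivative_def[symmetric] DERIV_deriv_iff_field_differentiable holomorphic_on_def)
    from has_derivative_compose[OF 1 this] show ?thesis .
  qed
  have "((\<lambda>p. g (of_real (fst p)) * h (of_real (snd p))) has_derivative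
     (\<lambda>v. g (of_real (fst p)) * (deriv h (of_real (snd p)) * of_real (snd v)) +
          deriv g (of_real (fst p)) * of_real (fst v) * h (of_real (snd p)))) (at p)"
    by (intro has_derivative_mult comp g h bounded_linear_fst bounded_linear_snd)
  moreover have "(\<lambda>p. g (of_real (fst p)) * h (of_real (snd p))) = prod_fun g h"
    by (simp add: prod_fun_def fun_eq_iff)
  moreover have "(\<lambda>v. g (of_real (fst p)) * (deriv h (of_real (snd p)) * of_real (snd v)) +
          deriv g (of_real (fst p)) * of_real (fst v) * h (of_real (snd p))) =
     (\<lambda>v. of_real (fst v) * prod_fun (deriv g) h p + of_real (snd v) * prod_fun g (deriv h) p)"
    by (simp add: prod_fun_def fun_eq_iff case_prod_beta algebra_simps)
  ultimately have *: "(prod_fun g h has_derivative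
     (\<lambda>v. of_real (fst v) * prod_fun (deriv g) h p + of_real (snd v) * prod_fun g (deriv h) p)) (at p)"
    by simp
  then show "prod_fun g h differentiable (at p)" by (auto simp: differentiable_def)
  show "frechet_derivative (prod_fun g h) (at p) v =
      of_real (fst v) * prod_fun (deriv g) h p + of_real (snd v) * prod_fun g (deriv h) p"
    using frechet_derivative_at[OF *] by metis
qed

lemma d_prod_fun:
  assumes "g holomorphic_on UNIV" "h holomorphic_on UNIV"
  shows "d_theta (prod_fun g h) = prod_fun (deriv g) h" "d_y (prod_fun g h) = prod_fun g (deriv h)"
  using assms by (auto simp: fun_eq_iff d_theta_def d_y_def frechet_derivative_prod_fun)

lemma smooth_prod_fun:
  assumes "g holomorphic_on UNIV" "h holomorphic_on UNIV"
  shows "smooth (prod_fun g h)"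
proof -
  have "Ck n (prod_fun g h)" for n
    using assms
  proof (induction n arbitrary: g h)
    case 0
    then have "isCont (prod_fun g h) p" for p
      by (intro differentiable_imp_continuous_within frechet_derivative_prod_fun(1))
    then show ?case by (simp add: continuous_at_imp_continuous_on)
  next
    case (Suc n)
    have "Ck n (\<lambda>p. of_real a * prod_fun (deriv g) h p + of_real b * prod_fun g (deriv h) p)" for a b
    proof -
      \<comment> \<open>The constants are absorbed into the first factor, so that each summand is
        again of the form covered by the induction hypothesis.\<close>
      have "Ck n (prod_fun (\<lambda>z. of_real a * deriv g z) h)" "Ck n (prod_fun (\<lambda>z. of_real b * g z) (deriv h))"
        using Suc.prems by (auto intro!: Suc.IH holomorphic_intros)
      from Ck_add[OF this] show ?thesis
        by (simp add: prod_fun_def case_prod_beta mult.assoc)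
    qed
    then show ?case using Suc.prems by (simp add: frechet_derivative_prod_fun)
  qed
  then show ?thesis by (simp add: smooth_def)
qed

definition weight_char :: "int \<Rightarrow> complex \<Rightarrow> complex" where
  "weight_char m z = exp (- \<i> * of_int m * z / 2)"

lemma weight_char_holomorphic: "weight_char m holomorphic_on UNIV"
  unfolding weight_char_def[abs_def] by (auto intro!: holomorphic_intros)

lemma deriv_weight_char: "deriv (weight_char m) z = - \<i> * of_int m / 2 * weight_char m z"
  unfolding weight_char_def[abs_def]
  by (rule DERIV_imp_deriv) (auto intro!: derivative_eq_intros)

lemma F_sol_prod: "F_sol m l = prod_fun (weight_char m) (radial m l)"
  by (simp add: F_sol_def prod_fun_def weight_char_def radial_def fun_eq_iff mult.assoc)

section \<open>Powers of \<open>\<i>\<close> and equivariance under the shift by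
  \<open>pi\<close>\<close>

lemma exp_half_pi_i: "exp (\<i> * of_int n * of_real pi / 2) = \<i> powi n"
proof -
  have "exp (\<i> * of_real pi / 2) = \<i>" by (metis cis_conv_exp cis_pi_half mult.commute of_real_divide of_real_numeral times_divide_eq_left)
  then have "\<i> powi n = exp (of_int n * (\<i> * of_real pi / 2))" by (metis exp_power_int)
  then show ?thesis by (simp add: mult_ac)
qed

lemma i_powi_eq_1_iff: "\<i> powi n = 1 \<longleftrightarrow> 4 dvd n"
proof -
  have "\<i> powi n = \<i> powi (4 * (n div 4)) * \<i> powi (n mod 4)"
    by (subst power_int_add[symmetric]) auto
  also have "\<i> powi (4 * (n div 4)) = 1"
    by (simp add: power_int_mult)
  finally have 1: "\<i> powi n = \<i> powi (n mod 4)" by simp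
  have "n mod 4 \<in> {0,1,2,3}" by auto
  then show ?thesis unfolding 1 dvd_eq_mod_eq_0
    by (auto simp: power_int_def power3_eq_cube nat_numeral complex_eq_iff)
qed

lemma weight_char_shift:
  "weight_char m (z + of_int j * of_real pi) = \<i> powi (- (j * m)) * weight_char m z"
proof -
  have "weight_char m (z + of_int j * of_real pi) = exp (\<i> * of_int (- (j * m)) * of_real pi / 2) * weight_char m z"
    unfolding weight_char_def by (simp add: exp_add[symmetric] algebra_simps add_divide_distrib diff_divide_distrib)
  then show ?thesis unfolding exp_half_pi_i .
qed

lemma i_powi_2: "\<i> powi (2 * n) = (-1) powi n"
  by (simp add: power_int_mult)

text \<open>Only \<open>z ^ l\<close> sees the sign, as the other factors depend on
  \<open>z\<^sup>2\<close>. A power of \<open>\<i>\<close> is used so that it combines with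
  \<open>weight_char_shift\<close>.\<close>

lemma radial_parity: "radial m l ((-1) powi j * z) = \<i> powi (2 * j * int l) * radial m l z"
proof -
  have "((-1) powi j)\<^sup>2 = (1 :: complex)"
    by (simp only: power2_eq_square power_int_minus_one_mult_self)
  then have "((-1) powi j * z)\<^sup>2 = z\<^sup>2" by (simp only: power_mult_distrib mult_1)
  moreover have "\<i> powi (2 * j * int l) = ((-1) powi j) ^ l"
    by (simp only: mult.assoc i_powi_2 power_int_mult[of _ j] power_int_of_nat)
  ultimately show ?thesis unfolding radial_def by (simp only: power_mult_distrib mult_ac)
qed

lemma F_sol_in_ker:
  assumes m: "[m = 2 * int l + q] (mod 4)" and lam: "2 * lam = real l * (real l - 1)"
  shows "F_sol m l \<in> ker_Omega2 q lam"
proof -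
  have "F_sol m l (\<theta> + of_int j * pi, (-1) powi j * y) = \<i> powi (- (j * q)) * F_sol m l (\<theta>, y)" for j \<theta> y
  proof -
    have dvd: "4 dvd - (j * (m - 2 * int l - q))"
      using m by (simp add: cong_iff_dvd_diff diff_diff_eq)
    \<comment> \<open>The total exponent differs from \<open>- (j * q)\<close> by a multiple of
      \<open>4\<close>, which is exactly the congruence on \<open>m\<close>.\<close>
    have split: "- (j * m) + 2 * j * int l = - (j * q) + - (j * (m - 2 * int l - q))"
      by (simp add: algebra_simps)
    have "\<i> powi (- (j * m)) * \<i> powi (2 * j * int l) = \<i> powi (- (j * m) + 2 * j * int l)"
      by (rule power_int_add[symmetric]) simp
    also have "\<dots> = \<i> powi (- (j * q)) * \<i> powi (- (j * (m - 2 * int l - q)))"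
      unfolding split by (rule power_int_add) simp
    also have "\<dots> = \<i> powi (- (j * q))"
      using dvd by (simp only: i_powi_eq_1_iff[THEN iffD2] mult_1_right)
    finally have *: "\<i> powi (- (j * m)) * \<i> powi (2 * j * int l) = \<i> powi (- (j * q))" .
    have "F_sol m l (\<theta> + of_int j * pi, (-1) powi j * y) =
      (\<i> powi (- (j * m)) * \<i> powi (2 * j * int l)) * F_sol m l (\<theta>, y)"
      using weight_char_shift[of m "of_real \<theta>" j] radial_parity[of m l j "of_real y"]
      by (simp add: F_sol_prod prod_fun_def of_real_power_int del: power_int_minus)
    then show ?thesis unfolding * .
  qed
  then have "F_sol m l \<in> I2 q"
    unfolding I2_def by (auto simp: F_sol_prod intro!: smooth_prod_fun weight_char_holomorphic radial_ode)
  moreover have "Omega2 (F_sol m l) p - 2 * of_real lam * F_sol m l p = 0" for p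
  proof -
    obtain \<theta> y where p: "p = (\<theta>, y)" by force
    note hol = weight_char_holomorphic[of m] radial_ode(1)[of m l] holomorphic_deriv[OF radial_ode(1)[of m l] open_UNIV]
    \<comment> \<open>On the character, \<open>2 * \<i>\<close> times the
      \<open>\<theta>\<close>-derivative is multiplication by \<open>m\<close>.\<close>
    have "Omega2 (F_sol m l) p = weight_char m (of_real \<theta>) * ((of_real y)\<^sup>2 *
       (deriv (deriv (radial m l)) (of_real y) + (of_int m - (of_real y)\<^sup>2) * radial m l (of_real y)))"
      unfolding Omega2_def p F_sol_prod d_prod_fun[OF hol(1,2)] d_prod_fun[OF hol(1,3)]
      by (simp add: prod_fun_def deriv_weight_char algebra_simps)
    also have "\<dots> = of_nat l * (of_nat l - 1) * F_sol m l p"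
      unfolding radial_ode(2) F_sol_prod prod_fun_def p by simp
    also have "of_nat l * (of_nat l - 1) = (2 * of_real lam :: complex)"
      using arg_cong[OF lam, of complex_of_real] by simp
    finally show ?thesis by simp
  qed
  ultimately show ?thesis unfolding ker_Omega2_def by blast
qed

lemma of_weight_F_sol: "of_weight m (F_sol m l)"
  unfolding of_weight_def F_sol_prod prod_fun_def weight_char_def
  by (intro exI[of _ "\<lambda>y. radial m l (of_real y)"]) simp

text \<open>For \<open>l > 0\<close> the function vanishes at \<open>y = 0\<close>, so evaluation
  there is no help. Instead the nonzero factors are cancelled for \<open>y \<noteq> 0\<close>, and
  the hypergeometric factor tends to \<open>1\<close>.\<close>

lemma F_sol_nonzero: "F_sol m l \<noteq> (\<lambda>_. 0)"
proof
  assume 0: "F_sol m l = (\<lambda>_. 0)"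
  define a :: complex where "a = (1 + 2 * of_nat l - of_int m) / 4"
  define b :: complex where "b = of_nat l + 1 / 2"
  have "hyp1F1 a b ((of_real y)\<^sup>2) = 0" if "y \<noteq> 0" for y :: real
    using fun_cong[OF 0, of "(0, y)"] that by (auto simp: F_sol_def a_def b_def)
  then have "((\<lambda>y::real. hyp1F1 a b ((of_real y)\<^sup>2)) \<longlongrightarrow> 0) (at 0)"
    by (intro tendsto_eventually) (auto simp: eventually_at_filter)
  moreover have "((\<lambda>y::real. hyp1F1 a b ((of_real y)\<^sup>2)) \<longlongrightarrow> 1) (at 0)"
  proof -
    have "b + of_nat n \<noteq> 0" for n
      unfolding b_def by (rule nat_plus_half_plus_nat_nonzero)
    from hyp1F1_kummer[OF this] have "isCont (hyp1F1 a b) ((of_real 0)\<^sup>2)"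
      using DERIV_isCont by blast
    then have "isCont (\<lambda>y::real. hyp1F1 a b ((of_real y)\<^sup>2)) 0"
      by (rule isCont_o2[rotated]) (intro continuous_intros)
    then show ?thesis unfolding isCont_def by simp
  qed
  ultimately have "(0 :: complex) = 1" by (rule LIM_unique)
  then show False by simp
qed

lemma of_weight_imp_K_finite:
  assumes "of_weight m F"
  shows "K_finite F"
  unfolding K_finite_def
proof (intro exI[of _ "{F}"] conjI allI)
  fix t
  from assms obtain f where f: "\<And>\<theta> y. F (\<theta>, y) = exp (- \<i> * of_int m * of_real \<theta> / 2) * f y"
    unfolding of_weight_def by blast
  have "K_act t F p = (\<Sum>G\<in>{F}. exp (- \<i> * of_int m * of_real t / 2) * G p)" for p
    by (cases p) (simp add: K_act_def f exp_add[symmetric] algebra_simps add_divide_distrib diff_divide_distrib)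
  then show "\<exists>c. \<forall>p. K_act t F p = (\<Sum>G\<in>{F}. c G * G p)"
    by (intro exI[of _ "\<lambda>_. exp (- \<i> * of_int m * of_real t / 2)"] allI)
qed simp

section \<open>Weight vectors in the kernel\<close>

definition solves :: "real \<Rightarrow> int \<Rightarrow> (nat \<Rightarrow> real \<Rightarrow> complex) \<Rightarrow> bool" where
  "solves lam m D \<longleftrightarrow> deriv_seq D \<and>
     (\<forall>y. (of_real y)\<^sup>2 * (D 2 y + (of_int m - (of_real y)\<^sup>2) * D 0 y) = 2 * of_real lam * D 0 y)"

lemma solves_diff:
  assumes "solves lam m D" "solves lam m E"
  shows "solves lam m (\<lambda>n y. D n y - c * E n y)"
proof -
  have "deriv_seq (\<lambda>n y. D n y + (- c) * E n y)"
    using assms unfolding solves_def by (intro deriv_seq_add deriv_seq_cmult) auto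
  moreover have "(of_real y)\<^sup>2 * (D 2 y - c * E 2 y + (of_int m - (of_real y)\<^sup>2) * (D 0 y - c * E 0 y)) =
     2 * of_real lam * (D 0 y - c * E 0 y)" for y
  proof -
    have "(of_real y)\<^sup>2 * (D 2 y - c * E 2 y + (of_int m - (of_real y)\<^sup>2) * (D 0 y - c * E 0 y)) =
      (of_real y)\<^sup>2 * (D 2 y + (of_int m - (of_real y)\<^sup>2) * D 0 y) -
      c * ((of_real y)\<^sup>2 * (E 2 y + (of_int m - (of_real y)\<^sup>2) * E 0 y))"
      by algebra
    also have "\<dots> = 2 * of_real lam * D 0 y - c * (2 * of_real lam * E 0 y)"
      using assms unfolding solves_def by simp
    finally show ?thesis by (simp add: algebra_simps)
  qed
  ultimately show ?thesis unfolding solves_def by simp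
qed

lemma solves_flat_imp_zero:
  assumes "solves lam m D" "\<And>n. D n 0 = 0" "y \<ge> 0"
  shows "D 0 y = 0"
proof (rule euler_ode_flat_imp_zero[where D = D])
  let ?Q = "\<lambda>y. 2 * of_real lam - (of_int m - (of_real y)\<^sup>2) * (of_real y)\<^sup>2 :: complex"
  show "(of_real y)\<^sup>2 * D 2 y = ?Q y * D 0 y" for y
    using assms(1) unfolding solves_def by (simp add: algebra_simps)
  show "continuous_on UNIV ?Q" by (intro continuous_intros)
qed (use assms in \<open>auto simp: solves_def\<close>)

text \<open>Differentiating the equation \<open>k\<close> times at \<open>y = 0\<close>, where \<open>k\<close> is the order of vanishing,
  leaves only the indicial equation.\<close>

lemma solves_indicial:
  assumes sol: "solves lam m D" and k: "D k 0 \<noteq> 0" "\<And>j. j < k \<Longrightarrow> D j 0 = 0"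
  shows "2 * lam = real k * (real k - 1)"
proof -
  \<comment> \<open>\<open>S\<close> lists the derivatives of the two sides' difference; each
    \<open>mult_id\<close> stands for one factor \<open>y\<close>.\<close>
  define S where "S = (\<lambda>n y. mult_id (mult_id (\<lambda>n. D (n + 2))) n y + of_int m * mult_id (mult_id D) n y
     + (- 1) * mult_id (mult_id (mult_id (mult_id D))) n y + (- 2 * of_real lam) * D n y)"
  have D: "deriv_seq D" using sol by (simp add: solves_def)
  then have "deriv_seq S"
    unfolding S_def by (intro deriv_seq_add deriv_seq_cmult deriv_seq_mult_id deriv_seq_shift)
  moreover have "deriv_seq (\<lambda>n y. 0)" by (simp add: deriv_seq_def)
  moreover have "S 0 y = 0" for y
  proof -
    have "S 0 y = (of_real y)\<^sup>2 * (D 2 y + (of_int m - (of_real y)\<^sup>2) * D 0 y) - 2 * of_real lam * D 0 y"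
      unfolding S_def mult_id_def by (simp add: algebra_simps power2_eq_square numeral_2_eq_2)
    then show ?thesis using sol by (simp add: solves_def)
  qed
  ultimately have "S k 0 = 0" by (rule deriv_seq_unique)
  moreover have mult_id_0: "mult_id H n 0 = of_nat n * H (n - 1) 0" for H n
    by (simp add: mult_id_def)
  have "S k 0 = (of_nat k * of_nat (k - 1) - 2 * of_real lam) * D k 0"
  proof (cases "k \<ge> 2")
    case True
    \<comment> \<open>At \<open>0\<close>, the terms with \<open>m\<close> and with
      \<open>y ^ 4\<close> involve only derivatives of order below \<open>k\<close>.\<close>
    then have "D (k - 1 - 1) 0 = 0" "D (k - 1 - 1 - 1 - 1) 0 = 0" "k - 1 - 1 + 2 = k"
      by (auto intro!: k(2))
    then show ?thesis unfolding S_def mult_id_0 by (simp add: algebra_simps)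
  next
    case False
    then have "k = 0 \<or> k = 1" by auto
    \<comment> \<open>Here the nested \<open>mult_id\<close> terms vanish through a factor
      \<open>of_nat 0\<close>, whatever the truncated indices are.\<close>
    then show ?thesis unfolding S_def mult_id_0 by auto
  qed
  ultimately have "of_nat k * of_nat (k - 1) = (2 * of_real lam :: complex)" using k(1) by simp
  then have "complex_of_real (real k * real (k - 1)) = of_real (2 * lam)" by simp
  then have "real k * real (k - 1) = 2 * lam" by (simp only: of_real_eq_iff)
  then show ?thesis by (cases k) auto
qed

lemma solves_nonzero_order:
  assumes "solves lam m D" "y \<ge> 0" "D 0 y \<noteq> 0"
  obtains k where "D k 0 \<noteq> 0" "\<And>j. j < k \<Longrightarrow> D j 0 = 0" "2 * lam = real k * (real k - 1)"
proof -
  from solves_flat_imp_zero[OF assms(1) _ assms(2)] assms(3) obtain n where n: "D n 0 \<noteq> 0" by blast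
  define k where "k = (LEAST n. D n 0 \<noteq> 0)"
  have "D k 0 \<noteq> 0" unfolding k_def using n by (rule LeastI)
  moreover have "D j 0 = 0" if "j < k" for j using not_less_Least that unfolding k_def by blast
  ultimately show thesis using solves_indicial[OF assms(1)] that by blast
qed

section \<open>From weight vectors on the plane to solutions of the radial equation\<close>

lemma smooth_imp_differentiable: "smooth F \<Longrightarrow> F differentiable (at p)"
  unfolding smooth_def by (metis Ck.simps(2))

lemma smooth_d_y: "smooth F \<Longrightarrow> smooth (d_y F)"
  unfolding smooth_def d_y_def[abs_def] by (metis Ck.simps(2))

lemma has_vector_derivative_d_y:
  assumes "smooth F"
  shows "((\<lambda>y. F (\<theta>, y)) has_vector_derivative d_y F (\<theta>, y)) (at y)"
proof -
  have F: "(F has_derivative frechet_derivative F (at (\<theta>, y))) (at (\<theta>, y))"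
    using smooth_imp_differentiable[OF assms] by (simp add: frechet_derivative_works)
  have 1: "((\<lambda>y. (\<theta>, y)) has_derivative (\<lambda>h. (0, h))) (at y)"
    by (intro derivative_eq_intros) auto
  have "((\<lambda>y. F (\<theta>, y)) has_derivative (\<lambda>h. frechet_derivative F (at (\<theta>, y)) (0, h))) (at y)"
    by (rule has_derivative_compose[OF 1 F])
  moreover have "frechet_derivative F (at (\<theta>, y)) (0, h) = h *\<^sub>R d_y F (\<theta>, y)" for h
    using linear_scale[OF has_derivative_linear[OF F], of h "(0, 1)"] by (simp add: d_y_def)
  ultimately show ?thesis by (simp add: has_vector_derivative_def)
qed

lemma has_vector_derivative_d_theta:
  assumes "smooth F"
  shows "((\<lambda>\<theta>. F (\<theta>, y)) has_vector_derivative d_theta F (\<theta>, y)) (at \<theta>)"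
proof -
  have F: "(F has_derivative frechet_derivative F (at (\<theta>, y))) (at (\<theta>, y))"
    using smooth_imp_differentiable[OF assms] by (simp add: frechet_derivative_works)
  have 1: "((\<lambda>\<theta>. (\<theta>, y)) has_derivative (\<lambda>h. (h, 0))) (at \<theta>)"
    by (intro derivative_eq_intros) auto
  have "((\<lambda>\<theta>. F (\<theta>, y)) has_derivative (\<lambda>h. frechet_derivative F (at (\<theta>, y)) (h, 0))) (at \<theta>)"
    by (rule has_derivative_compose[OF 1 F])
  moreover have "frechet_derivative F (at (\<theta>, y)) (h, 0) = h *\<^sub>R d_theta F (\<theta>, y)" for h
    using linear_scale[OF has_derivative_linear[OF F], of h "(1, 0)"] by (simp add: d_theta_def)
  ultimately show ?thesis by (simp add: has_vector_derivative_def)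
qed

lemma weight_vector_solves:
  assumes F: "F \<in> ker_Omega2 q lam" and wt: "of_weight m F"
  obtains D where "solves lam m D" "\<And>\<theta> y. F (\<theta>, y) = weight_char m (of_real \<theta>) * D 0 y"
    "\<And>y. D 0 (- y) = \<i> powi (m - q) * D 0 y"
proof -
  have sm: "smooth F" using F by (simp add: ker_Omega2_def I2_def)
  from wt obtain f where f: "\<And>\<theta> y. F (\<theta>, y) = weight_char m (of_real \<theta>) * f y"
    unfolding of_weight_def weight_char_def by blast
  \<comment> \<open>The line \<open>\<theta> = 0\<close> is used because the character equals
    \<open>1\<close> there, so \<open>D 0\<close> is the radial factor itself.\<close>
  define D where "D = (\<lambda>n y. (d_y ^^ n) F (0, y))"
  have D0: "D 0 = f" by (simp add: D_def f weight_char_def fun_eq_iff)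
  have "smooth ((d_y ^^ n) F)" for n
    by (induction n) (auto simp: sm smooth_d_y)
  then have "deriv_seq D"
    unfolding deriv_seq_def D_def by (auto intro: has_vector_derivative_d_y)
  moreover have "(of_real y)\<^sup>2 * (D 2 y + (of_int m - (of_real y)\<^sup>2) * D 0 y) = 2 * of_real lam * D 0 y" for y
  proof -
    have "(weight_char m has_field_derivative - \<i> * of_int m / 2) (at (of_real 0))"
      unfolding weight_char_def[abs_def] by (auto intro!: derivative_eq_intros)
    from has_vector_derivative_mult_left[OF has_vector_derivative_real_field[OF this], of "f y"]
    have "((\<lambda>\<theta>. F (\<theta>, y)) has_vector_derivative - \<i> * of_int m / 2 * f y) (at 0)"
      by (simp add: f)
    then have "d_theta F (0, y) = - \<i> * of_int m / 2 * f y"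
      using has_vector_derivative_d_theta[OF sm] vector_derivative_unique_at by blast
    moreover have "Omega2 F (0, y) - 2 * of_real lam * F (0, y) = 0"
      using F by (simp add: ker_Omega2_def)
    moreover have "D 2 y = d_y (d_y F) (0, y)" by (simp add: D_def numeral_2_eq_2)
    moreover have "F (0, y) = D 0 y" by (simp add: D_def)
    ultimately show ?thesis unfolding Omega2_def D0[symmetric] by (simp add: algebra_simps)
  qed
  moreover have "D 0 (- y) = \<i> powi (m - q) * D 0 y" for y
  proof -
    \<comment> \<open>Starting from \<open>- pi\<close>, the shift with \<open>j = 1\<close> lands
      on \<open>\<theta> = 0\<close> and reflects \<open>y\<close>.\<close>
    have "F (- pi + of_int 1 * pi, (-1) powi 1 * y) = \<i> powi (- (1 * q)) * F (- pi, y)"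
      using F unfolding ker_Omega2_def I2_def by blast
    then have "f (- y) = \<i> powi (- q) * (weight_char m (- of_real pi) * f y)"
      by (simp add: f weight_char_def)
    also have "weight_char m (- of_real pi) = \<i> powi m"
      using weight_char_shift[of m 0 "-1"] by (simp add: weight_char_def)
    finally have "f (- y) = (\<i> powi m * \<i> powi (- q)) * f y" by (simp add: mult_ac)
    also have "\<i> powi m * \<i> powi (- q) = \<i> powi (m - q)"
      by (subst power_int_add[symmetric]) auto
    finally show ?thesis by (simp add: D0)
  qed
  ultimately show thesis using f that[of D] unfolding solves_def D0 by blast
qed

section \<open>The indicial roots and the parameter \<open>ell\<close>\<close>

lemma ell_eq_iff:
  assumes "l > 0"
  shows "ell lam = of_nat l \<longleftrightarrow> 2 * lam = real l * (real l - 1)"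
proof -
  have sq: "1 + 8 * complex_of_real lam = (2 * of_nat l - 1)\<^sup>2 \<longleftrightarrow> 2 * lam = real l * (real l - 1)"
  proof -
    have "1 + 8 * complex_of_real lam = (2 * of_nat l - 1)\<^sup>2 \<longleftrightarrow>
        complex_of_real (1 + 8 * lam) = complex_of_real ((2 * real l - 1)\<^sup>2)"
      by simp
    also have "\<dots> \<longleftrightarrow> 1 + 8 * lam = (2 * real l - 1)\<^sup>2" by (simp only: of_real_eq_iff)
    also have "\<dots> \<longleftrightarrow> 2 * lam = real l * (real l - 1)" by (auto simp: power2_eq_square algebra_simps)
    finally show ?thesis .
  qed
  have "ell lam = of_nat l \<longleftrightarrow> csqrt (1 + 8 * of_real lam) = 2 * of_nat l - 1"
    by (auto simp: ell_def field_simps)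
  also have "\<dots> \<longleftrightarrow> 1 + 8 * complex_of_real lam = (2 * of_nat l - 1)\<^sup>2"
  proof
    assume "1 + 8 * complex_of_real lam = (2 * of_nat l - 1)\<^sup>2"
    \<comment> \<open>For \<open>l > 0\<close> the number \<open>2 * l - 1\<close> is positive,
      hence it is the principal root.\<close>
    then show "csqrt (1 + 8 * of_real lam) = 2 * of_nat l - 1"
      using assms by (intro csqrt_unique) auto
  qed (metis power2_csqrt)
  finally show ?thesis unfolding sq .
qed

text \<open>Distinct roots of \<open>k (k - 1) = const\<close> add up to \<open>1\<close>; a nonzero
  constant forces \<open>l \<ge> 2\<close>, so the other root is negative.\<close>

lemma indicial_roots:
  assumes "real k * (real k - 1) = real l * (real l - 1)" "real l * (real l - 1) \<noteq> 0"
  shows "k = l"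
proof -
  have "(real k - real l) * (real k + real l - 1) = 0" using assms(1) by (simp add: algebra_simps)
  moreover have "real l \<ge> 2" using assms(2) by (cases l; cases "l - 1") auto
  then have "real k + real l - 1 \<noteq> 0" using of_nat_0_le_iff[of k, where 'a = real] by linarith
  ultimately show ?thesis by simp
qed

lemma weight_vector_order:
  assumes F: "F \<in> ker_Omega2 q lam" "of_weight m F" "F \<noteq> (\<lambda>_. 0)"
  obtains k where "2 * lam = real k * (real k - 1)" "[m = 2 * int k + q] (mod 4)"
proof -
  obtain D where D: "solves lam m D" and FD: "\<And>\<theta> y. F (\<theta>, y) = weight_char m (of_real \<theta>) * D 0 y"
    and par: "\<And>y. D 0 (- y) = \<i> powi (m - q) * D 0 y"
    using weight_vector_solves[OF F(1,2)] by blast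
  from F(3) obtain \<theta> y where "F (\<theta>, y) \<noteq> 0" by (auto simp: fun_eq_iff)
  \<comment> \<open>The reflection relation moves a nonzero value to the half-line
    \<open>y \<ge> 0\<close>, where the flatness argument applies.\<close>
  then have "D 0 \<bar>y\<bar> \<noteq> 0" using par[of "\<bar>y\<bar>"] FD by (cases "y \<ge> 0") auto
  then obtain k where k: "D k 0 \<noteq> 0" and lam: "2 * lam = real k * (real k - 1)"
    using solves_nonzero_order[OF D, of "\<bar>y\<bar>"] by auto
  \<comment> \<open>The reflection relation is differentiated \<open>k\<close> times at
    \<open>0\<close>, and the nonzero value \<open>D k 0\<close> is then cancelled.\<close>
  have "(-1) ^ k * D k (- 0) = \<i> powi (m - q) * D k 0"
    by (rule deriv_seq_unique[OF deriv_seq_reflect deriv_seq_cmult])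
       (use D par in \<open>auto simp: solves_def\<close>)
  then have "\<i> powi (m - q) = \<i> powi (2 * int k)" using k by (simp only: i_powi_2) simp
  then have "\<i> powi (m - q - 2 * int k) = 1" by (simp add: power_int_diff)
  then have "[m = 2 * int k + q] (mod 4)"
    unfolding i_powi_eq_1_iff cong_iff_dvd_diff by (simp add: algebra_simps)
  with lam show thesis by (rule that)
qed

lemma weight_vector_unique:
  assumes F: "F \<in> ker_Omega2 q lam" "of_weight m F" and lam: "lam \<noteq> 0"
    and G: "G \<in> ker_Omega2 q lam" "of_weight m G" "G \<noteq> (\<lambda>_. 0)"
  shows "\<exists>c. \<forall>p. F p = c * G p"
proof -
  obtain D where D: "solves lam m D" and FD: "\<And>\<theta> y. F (\<theta>, y) = weight_char m (of_real \<theta>) * D 0 y"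
    and parD: "\<And>y. D 0 (- y) = \<i> powi (m - q) * D 0 y"
    using weight_vector_solves[OF F(1,2)] by blast
  obtain E where E: "solves lam m E" and GE: "\<And>\<theta> y. G (\<theta>, y) = weight_char m (of_real \<theta>) * E 0 y"
    and parE: "\<And>y. E 0 (- y) = \<i> powi (m - q) * E 0 y"
    using weight_vector_solves[OF G(1,2)] by blast
  from G(3) obtain \<theta> y where "G (\<theta>, y) \<noteq> 0" by (auto simp: fun_eq_iff)
  then have "E 0 \<bar>y\<bar> \<noteq> 0" using parE[of "\<bar>y\<bar>"] GE by (cases "y \<ge> 0") auto
  then obtain l where l: "E l 0 \<noteq> 0" and laml: "2 * lam = real l * (real l - 1)"
    using solves_nonzero_order[OF E, of "\<bar>y\<bar>"] by auto
  \<comment> \<open>This choice cancels the derivative of order \<open>l\<close> at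
    \<open>0\<close>. A nonzero \<open>H\<close> would have to vanish to order exactly
    \<open>l\<close>, the only admissible order when \<open>lam \<noteq> 0\<close>.\<close>
  define c where "c = D l 0 / E l 0"
  define H where "H = (\<lambda>n y. D n y - c * E n y)"
  have H: "solves lam m H" unfolding H_def by (rule solves_diff[OF D E])
  have H_pos: "H 0 y = 0" if y: "y \<ge> 0" for y
  proof (rule ccontr)
    assume "H 0 y \<noteq> 0"
    then obtain k where k: "H k 0 \<noteq> 0" "2 * lam = real k * (real k - 1)"
      using solves_nonzero_order[OF H y] by blast
    have "k = l" by (rule indicial_roots) (use laml lam k(2) in linarith)+
    then show False using k(1) l by (simp add: H_def c_def)
  qed
  have "H 0 y = 0" for y
  proof (cases "y \<ge> 0")
    case False
    have "H 0 y = \<i> powi (m - q) * H 0 (- y)"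
      using parD[of "- y"] parE[of "- y"] by (simp add: H_def algebra_simps)
    then show ?thesis using H_pos[of "- y"] False by simp
  qed (rule H_pos)
  then have "F (\<theta>, y) = c * G (\<theta>, y)" for \<theta> y by (simp add: FD GE H_def mult_ac)
  then show ?thesis by (intro exI[of _ c]) auto
qed

text \<open>The disjunct with \<open>lam = 0\<close> and \<open>[m = q] (mod 4)\<close> records
  solutions of order \<open>0\<close> at the origin. The parameter \<open>ell\<close> does not
  detect them, since \<open>ell 0 = 1\<close>.\<close>

theorem proposition5:
  fixes lam :: real and q m :: int
  shows "((\<exists>F \<in> ker_Omega2 q lam. F \<noteq> (\<lambda>_. 0) \<and> K_finite F \<and> of_weight m F) \<longleftrightarrow>
            (\<exists>l::nat. l > 0 \<and> ell lam = of_nat l \<and> [m = 2 * int l + q] (mod 4)) \<or>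
            (lam = 0 \<and> [m = q] (mod 4))) \<and>
         (\<forall>l::nat. l > 0 \<longrightarrow> (ell lam = of_nat l \<longleftrightarrow> lam = real l * (real l - 1) / 2)) \<and>
         (\<forall>l::nat. l > 0 \<and> ell lam = of_nat l \<and> [m = 2 * int l + q] (mod 4) \<and> lam \<noteq> 0 \<longrightarrow>
            F_sol m l \<in> ker_Omega2 q lam \<and> of_weight m (F_sol m l) \<and> F_sol m l \<noteq> (\<lambda>_. 0) \<and>
            (\<forall>F \<in> ker_Omega2 q lam. of_weight m F \<longrightarrow> (\<exists>c. \<forall>p. F p = c * F_sol m l p)))"
    (is "(?ex \<longleftrightarrow> ?pos \<or> ?zero) \<and> ?ell \<and> ?unique")
proof (intro conjI)
  have sol: "F_sol m l \<in> ker_Omega2 q lam"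
    if "l > 0" "ell lam = of_nat l" "[m = 2 * int l + q] (mod 4)" for l
    using that by (intro F_sol_in_ker) (simp_all add: ell_eq_iff)
  show "?ex \<longleftrightarrow> ?pos \<or> ?zero"
  proof
    assume ?ex
    then obtain F where "F \<in> ker_Omega2 q lam" "of_weight m F" "F \<noteq> (\<lambda>_. 0)" by blast
    then obtain k where k: "2 * lam = real k * (real k - 1)" "[m = 2 * int k + q] (mod 4)"
      by (rule weight_vector_order)
    show "?pos \<or> ?zero"
    \<comment> \<open>Order \<open>0\<close> forces \<open>lam = 0\<close> by the indicial equation;
      a positive order is the value of \<open>ell lam\<close>.\<close>
    proof (cases "k = 0")
      case True
      with k show ?thesis by simp
    next
      case False
      then have "?pos" using k ell_eq_iff[of k lam] by (intro exI[of _ k]) simp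
      then show ?thesis ..
    qed
  next
    assume "?pos \<or> ?zero"
    then obtain l where l: "F_sol m l \<in> ker_Omega2 q lam"
    proof
      assume ?pos
      then show thesis using sol that by blast
    next
      assume ?zero
      then show thesis using F_sol_in_ker[of m 0 q lam] that[of 0] by simp
    qed
    show ?ex
      by (intro bexI[OF _ l] conjI F_sol_nonzero of_weight_F_sol
          of_weight_imp_K_finite[OF of_weight_F_sol])
  qed
  show ?ell by (auto simp: ell_eq_iff field_simps)
  show ?unique
  proof (intro allI impI, elim conjE)
    fix l :: nat
    assume "l > 0" "ell lam = of_nat l" "[m = 2 * int l + q] (mod 4)" and lam: "lam \<noteq> 0"
    then have l: "F_sol m l \<in> ker_Omega2 q lam" by (intro sol)
    show "F_sol m l \<in> ker_Omega2 q lam \<and> of_weight m (F_sol m l) \<and> F_sol m l \<noteq> (\<lambda>_. 0) \<and>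
        (\<forall>F \<in> ker_Omega2 q lam. of_weight m F \<longrightarrow> (\<exists>c. \<forall>p. F p = c * F_sol m l p))"
      by (intro conjI ballI impI l F_sol_nonzero of_weight_F_sol
          weight_vector_unique[OF _ _ lam l of_weight_F_sol F_sol_nonzero])
  qed
qed

end
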